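(* Let $E$ and $F$ be (real, Archimedean) locally convex-solid vector lattices whose topologies are generated by families of Riesz seminorms $(p_{\alpha})_{\alpha\in I}$ and $(q_{\beta})_{\beta\in J}$, respectively. Then for all $\alpha\in I$, $\beta\in J$ and $u\in E\overline{\otimes}F$, \[(p_{\alpha}\otimes q_{\beta})(u)=\inf\left\{\sum_{i=1}^{n}p_{\alpha}(x_i)q_{\beta}(y_i)\;:\; n\in\mathbb{N},\ x_i\in E,\ y_i\in F,\ x_i,y_i\geq 0,\ |u|\leq \sum_{i=1}^{n}x_i\otimes y_i\right\}.\]
   Context: All vector lattices are real. A subset $A$ of a vector lattice is solid if $|x|\le |y|$ and $y\in A$ imply $x\in A$. A locally convex-solid vector lattice is a vector lattice with a linear topology (not assumed Hausdorff) having a base of zero neighborhoods consisting of convex solid sets; such a topology is always generated by a family of Riesz seminorms, i.e. seminorms $p$ such that $|x|\le|y|$ implies $p(x)\le p(y)$. A lattice bimorphism $\Phi:E\times F\to G$ between vector lattices is a bilinear map with $|\Phi(x,y)|=\Phi(|x|,|y|)$. For Archimedean vector lattices $E,F$, the Fremlin tensor product $E\overline{\otimes}F$ is the Archimedean vector lattice (unique up to lattice isomorphism) such that: the algebraic tensor product $E\otimes F$ is a vector subspace of $E\overline{\otimes}F$ (an ordered vector subspace with the induced order) and $(x,y)\mapsto x\otimes y$ is a lattice bimorphism; the vector sublattice generated by $E\otimes F$ is all of $E\overline{\otimes}F$; and for every Archimedean vector lattice $G$ and every lattice bimorphism $\Phi:E\times F\to G$ there is a unique lattice homomorphism $T:E\overline{\otimes}F\to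 G$ with $T(x\otimes y)=\Phi(x,y)$ for all $x\in E$, $y\in F$. For a subset $A$ of a vector lattice $H$, put $Sol(A)=\{x\in H: \exists y\in A,\ |x|\leq |y|\}$ and $Conv_b(A)=\{\sum_{i=1}^{n}\lambda_i x_i: n\in\mathbb{N},\ \lambda_i\in\mathbb{R},\ x_i\in A,\ \sum_{i=1}^{n}|\lambda_i|\leq 1\}$. Let $U_{\alpha}=\{x\in E: p_{\alpha}(x)\le 1\}$, $V_{\beta}=\{y\in F: q_{\beta}(y)\le 1\}$, $U_{\alpha}\otimes V_{\beta}=\{x\otimes y: x\in U_{\alpha},\ y\in V_{\beta}\}\subseteq E\overline{\otimes}F$, and $W_{\alpha,\beta}=Conv_b(Sol(U_{\alpha}\otimes V_{\beta}))$, with $Sol$ and $Conv_b$ taken in $E\overline{\otimes}F$. The function $p_{\alpha}\otimes q_{\beta}$ on $E\overline{\otimes}F$ is defined by $(p_{\alpha}\otimes q_{\beta})(u)=\inf\{r>0: u\in rW_{\alpha,\beta}\}$. *)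

theory Defs
  imports "HOL-Analysis.Analysis" "HOL-Library.Lattice_Algebras" "HOL-Library.Poly_Mapping"
begin

class vector_lattice = ordered_real_vector + lattice_ab_group_add_abs

class archimedean_vector_lattice = vector_lattice +
  assumes archimedean: "(\<forall>n::nat. real n *\<^sub>R x \<le> y) \<Longrightarrow> x \<le> 0"

instance real :: archimedean_vector_lattice
proof
  fix x y :: real
  assume "\<forall>n::nat. real n *\<^sub>R x \<le> y"
  then show "x \<le> 0"
    by (metis linorder_not_less mult.commute reals_Archimedean3 real_scaleR_def)
qed

definition solid :: "'a::vector_lattice set \<Rightarrow> bool" where
  "solid A \<longleftrightarrow> (\<forall>x y. \<bar>x\<bar> \<le> \<bar>y\<bar> \<and> y \<in> A \<longrightarrow> x \<in> A)"

definition Sol :: "'a::vector_lattice set \<Rightarrow> 'a set" where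
  "Sol A = {x. \<exists>y\<in>A. \<bar>x\<bar> \<le> \<bar>y\<bar>}"

definition Conv_b :: "'a::real_vector set \<Rightarrow> 'a set" where
  "Conv_b A = {\<Sum>i<n. l i *\<^sub>R x i | (n::nat) l x. (\<forall>i<n. x i \<in> A) \<and> (\<Sum>i<n. \<bar>l i\<bar>) \<le> (1::real)}"


subsection \<open>Riesz seminorms and locally convex-solid topologies\<close>

definition riesz_seminorm :: "('a::vector_lattice \<Rightarrow> real) \<Rightarrow> bool" where
  "riesz_seminorm p \<longleftrightarrow>
     (\<forall>x y. p (x + y) \<le> p x + p y) \<and>
     (\<forall>c x. p (c *\<^sub>R x) = \<bar>c\<bar> * p x) \<and>
     (\<forall>x y. \<bar>x\<bar> \<le> \<bar>y\<bar> \<longrightarrow> p x \<le> p y)"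

definition linear_topology :: "'a::real_vector topology \<Rightarrow> bool" where
  "linear_topology \<tau> \<longleftrightarrow>
     topspace \<tau> = UNIV \<and>
     continuous_map (prod_topology \<tau> \<tau>) \<tau> (\<lambda>(x, y). x + y) \<and>
     continuous_map (prod_topology euclideanreal \<tau>) \<tau> (\<lambda>(c, x). c *\<^sub>R x)"

definition locally_convex_solid :: "'a::vector_lattice topology \<Rightarrow> bool" where
  "locally_convex_solid \<tau> \<longleftrightarrow>
     linear_topology \<tau> \<and>
     (\<forall>U. openin \<tau> U \<and> 0 \<in> U \<longrightarrow>
        (\<exists>V W. openin \<tau> V \<and> 0 \<in> V \<and> V \<subseteq> W \<and> W \<subseteq> U \<and> convex W \<and> solid W))"

text \<open>\<^term>\<open>UNIV\<close> is inserted so that the empty family generates the indiscrete topology.\<close>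

definition seminorm_topology :: "'i set \<Rightarrow> ('i \<Rightarrow> 'a::real_vector \<Rightarrow> real) \<Rightarrow> 'a topology" where
  "seminorm_topology I p =
     topology_generated_by (insert UNIV {{y. p i (y - x) < r} | i x r. i \<in> I \<and> r > 0})"


subsection \<open>The Fremlin tensor product\<close>

definition lattice_bimorphism ::
    "('a::vector_lattice \<Rightarrow> 'b::vector_lattice \<Rightarrow> 'c::vector_lattice) \<Rightarrow> bool" where
  "lattice_bimorphism \<Phi> \<longleftrightarrow> bilinear \<Phi> \<and> (\<forall>x y. \<bar>\<Phi> x y\<bar> = \<Phi> \<bar>x\<bar> \<bar>y\<bar>)"

definition vector_sublattice :: "'a::vector_lattice set \<Rightarrow> bool" where
  "vector_sublattice S \<longleftrightarrow> subspace S \<and> (\<forall>x\<in>S. \<forall>y\<in>S. sup x y \<in> S \<and> inf x y \<in> S)"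

text \<open>The algebraic tensor product is the quotient of the free vector space on \<^typ>\<open>'a \<times> 'b\<close>
  by the subspace \<open>bilinear_relations\<close>.\<close>

inductive_set bilinear_relations :: "('a::real_vector \<times> 'b::real_vector \<Rightarrow>\<^sub>0 real) set" where
  add_left: "Poly_Mapping.single (x + x', y) 1 - Poly_Mapping.single (x, y) 1
     - Poly_Mapping.single (x', y) 1 \<in> bilinear_relations"
| add_right: "Poly_Mapping.single (x, y + y') 1 - Poly_Mapping.single (x, y) 1
     - Poly_Mapping.single (x, y') 1 \<in> bilinear_relations"
| scale_left: "Poly_Mapping.single (c *\<^sub>R x, y) 1 - Poly_Mapping.single (x, y) c
     \<in> bilinear_relations"
| scale_right: "Poly_Mapping.single (x, c *\<^sub>R y) 1 - Poly_Mapping.single (x, y) c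
     \<in> bilinear_relations"
| sum: "f \<in> bilinear_relations \<Longrightarrow> g \<in> bilinear_relations \<Longrightarrow> f + g \<in> bilinear_relations"
| scale: "f \<in> bilinear_relations \<Longrightarrow> Poly_Mapping.map ((*) c) f \<in> bilinear_relations"

definition tensor_eval ::
    "('a \<Rightarrow> 'b \<Rightarrow> 'h::real_vector) \<Rightarrow> ('a \<times> 'b \<Rightarrow>\<^sub>0 real) \<Rightarrow> 'h" where
  "tensor_eval t f = (\<Sum>(x, y)\<in>Poly_Mapping.keys f. Poly_Mapping.lookup f (x, y) *\<^sub>R t x y)"

text \<open>For bilinear \<open>t\<close>: the linear map that \<open>t\<close> induces on the algebraic tensor product is
  injective, so that its range, the span of the elements \<open>t x y\<close>, is a copy of the algebraic
  tensor product.\<close>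

definition embeds_tensors :: "('a::real_vector \<Rightarrow> 'b::real_vector \<Rightarrow> 'h::real_vector) \<Rightarrow> bool" where
  "embeds_tensors t \<longleftrightarrow> (\<forall>f. tensor_eval t f = 0 \<longrightarrow> f \<in> bilinear_relations)"

text \<open>The universal property quantifies over vector lattices, hence the following notion of a
  vector lattice with explicit carrier.\<close>

record 'g vlat =
  vcarrier :: "'g set"
  vadd :: "'g \<Rightarrow> 'g \<Rightarrow> 'g"
  vzero :: 'g
  vscale :: "real \<Rightarrow> 'g \<Rightarrow> 'g"
  vle :: "'g \<Rightarrow> 'g \<Rightarrow> bool"
  vsup :: "'g \<Rightarrow> 'g \<Rightarrow> 'g"
  vinf :: "'g \<Rightarrow> 'g \<Rightarrow> 'g"

locale archimedean_vlat =
  fixes G :: "'g vlat" (structure)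
  assumes zero_closed: "vzero G \<in> vcarrier G"
    and add_closed: "x \<in> vcarrier G \<Longrightarrow> y \<in> vcarrier G \<Longrightarrow> vadd G x y \<in> vcarrier G"
    and scale_closed: "x \<in> vcarrier G \<Longrightarrow> vscale G c x \<in> vcarrier G"
    and sup_closed: "x \<in> vcarrier G \<Longrightarrow> y \<in> vcarrier G \<Longrightarrow> vsup G x y \<in> vcarrier G"
    and inf_closed: "x \<in> vcarrier G \<Longrightarrow> y \<in> vcarrier G \<Longrightarrow> vinf G x y \<in> vcarrier G"
    and add_assoc: "x \<in> vcarrier G \<Longrightarrow> y \<in> vcarrier G \<Longrightarrow> z \<in> vcarrier G \<Longrightarrow>
          vadd G (vadd G x y) z = vadd G x (vadd G y z)"
    and add_commute: "x \<in> vcarrier G \<Longrightarrow> y \<in> vcarrier G \<Longrightarrow> vadd G x y = vadd G y x"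
    and add_zero: "x \<in> vcarrier G \<Longrightarrow> vadd G (vzero G) x = x"
    and add_neg: "x \<in> vcarrier G \<Longrightarrow> vadd G x (vscale G (-1) x) = vzero G"
    and scale_add_right: "x \<in> vcarrier G \<Longrightarrow> y \<in> vcarrier G \<Longrightarrow>
          vscale G c (vadd G x y) = vadd G (vscale G c x) (vscale G c y)"
    and scale_add_left: "x \<in> vcarrier G \<Longrightarrow>
          vscale G (c + d) x = vadd G (vscale G c x) (vscale G d x)"
    and scale_scale: "x \<in> vcarrier G \<Longrightarrow> vscale G c (vscale G d x) = vscale G (c * d) x"
    and scale_one: "x \<in> vcarrier G \<Longrightarrow> vscale G 1 x = x"
    and le_refl: "x \<in> vcarrier G \<Longrightarrow> vle G x x"
    and le_trans: "x \<in> vcarrier G \<Longrightarrow> y \<in> vcarrier G \<Longrightarrow> z \<in> vcarrier G \<Longrightarrow>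
          vle G x y \<Longrightarrow> vle G y z \<Longrightarrow> vle G x z"
    and le_antisym: "x \<in> vcarrier G \<Longrightarrow> y \<in> vcarrier G \<Longrightarrow> vle G x y \<Longrightarrow> vle G y x \<Longrightarrow> x = y"
    and add_mono: "x \<in> vcarrier G \<Longrightarrow> y \<in> vcarrier G \<Longrightarrow> z \<in> vcarrier G \<Longrightarrow>
          vle G x y \<Longrightarrow> vle G (vadd G x z) (vadd G y z)"
    and scale_mono: "x \<in> vcarrier G \<Longrightarrow> y \<in> vcarrier G \<Longrightarrow> 0 \<le> c \<Longrightarrow>
          vle G x y \<Longrightarrow> vle G (vscale G c x) (vscale G c y)"
    and sup_ub1: "x \<in> vcarrier G \<Longrightarrow> y \<in> vcarrier G \<Longrightarrow> vle G x (vsup G x y)"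
    and sup_ub2: "x \<in> vcarrier G \<Longrightarrow> y \<in> vcarrier G \<Longrightarrow> vle G y (vsup G x y)"
    and sup_least: "x \<in> vcarrier G \<Longrightarrow> y \<in> vcarrier G \<Longrightarrow> z \<in> vcarrier G \<Longrightarrow>
          vle G x z \<Longrightarrow> vle G y z \<Longrightarrow> vle G (vsup G x y) z"
    and inf_lb1: "x \<in> vcarrier G \<Longrightarrow> y \<in> vcarrier G \<Longrightarrow> vle G (vinf G x y) x"
    and inf_lb2: "x \<in> vcarrier G \<Longrightarrow> y \<in> vcarrier G \<Longrightarrow> vle G (vinf G x y) y"
    and inf_greatest: "x \<in> vcarrier G \<Longrightarrow> y \<in> vcarrier G \<Longrightarrow> z \<in> vcarrier G \<Longrightarrow>
          vle G z x \<Longrightarrow> vle G z y \<Longrightarrow> vle G z (vinf G x y)"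
    and archimedean: "x \<in> vcarrier G \<Longrightarrow> y \<in> vcarrier G \<Longrightarrow>
          (\<And>n::nat. vle G (vscale G (real n) x) y) \<Longrightarrow> vle G x (vzero G)"

definition vabs :: "'g vlat \<Rightarrow> 'g \<Rightarrow> 'g" where
  "vabs G x = vsup G x (vscale G (-1) x)"

definition lattice_bimorphism_into ::
    "'g vlat \<Rightarrow> ('a::vector_lattice \<Rightarrow> 'b::vector_lattice \<Rightarrow> 'g) \<Rightarrow> bool" where
  "lattice_bimorphism_into G \<Phi> \<longleftrightarrow>
     (\<forall>x y. \<Phi> x y \<in> vcarrier G) \<and>
     (\<forall>x x' y. \<Phi> (x + x') y = vadd G (\<Phi> x y) (\<Phi> x' y)) \<and>
     (\<forall>x y y'. \<Phi> x (y + y') = vadd G (\<Phi> x y) (\<Phi> x y')) \<and>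
     (\<forall>c x y. \<Phi> (c *\<^sub>R x) y = vscale G c (\<Phi> x y)) \<and>
     (\<forall>c x y. \<Phi> x (c *\<^sub>R y) = vscale G c (\<Phi> x y)) \<and>
     (\<forall>x y. vabs G (\<Phi> x y) = \<Phi> \<bar>x\<bar> \<bar>y\<bar>)"

definition lattice_hom_into :: "'g vlat \<Rightarrow> ('h::vector_lattice \<Rightarrow> 'g) \<Rightarrow> bool" where
  "lattice_hom_into G T \<longleftrightarrow>
     (\<forall>u. T u \<in> vcarrier G) \<and>
     (\<forall>u v. T (u + v) = vadd G (T u) (T v)) \<and>
     (\<forall>c u. T (c *\<^sub>R u) = vscale G c (T u)) \<and>
     (\<forall>u v. T (sup u v) = vsup G (T u) (T v)) \<and>
     (\<forall>u v. T (inf u v) = vinf G (T u) (T v))"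

definition type_vlat :: "'g::vector_lattice vlat" where
  "type_vlat = \<lparr>vcarrier = UNIV, vadd = (+), vzero = 0, vscale = scaleR, vle = (\<le>),
     vsup = sup, vinf = inf\<rparr>"

lemma archimedean_type_vlat: "archimedean_vlat (type_vlat :: 'g::archimedean_vector_lattice vlat)"
  by unfold_locales
     (auto simp: type_vlat_def algebra_simps scaleR_left_mono intro: archimedean)

lemma lattice_bimorphism_into_type_vlat:
  "lattice_bimorphism_into type_vlat \<Phi> \<longleftrightarrow> lattice_bimorphism \<Phi>"
  unfolding lattice_bimorphism_into_def lattice_bimorphism_def type_vlat_def vabs_def
    bilinear_def linear_iff by (auto simp: abs_lattice)

text \<open>\<open>fremlin_tensor_product t\<close>: the vector lattice \<^typ>\<open>'h\<close> together with the tensor map \<open>t\<close> is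
  a Fremlin tensor product of \<^typ>\<open>'a\<close> and \<^typ>\<open>'b\<close>; the order on the algebraic tensor product
  is the one induced from \<^typ>\<open>'h\<close>.

  In the universal property, \<open>G\<close> ranges over all Archimedean vector lattices whose elements are
  taken from \<^typ>\<open>'h\<close>. This is no restriction. The values of a lattice bimorphism \<open>\<Phi>\<close> generate
  a vector sublattice whose cardinality is at most that of \<^typ>\<open>'h\<close> (if \<open>\<Phi> x y \<noteq> 0\<close> for some
  \<open>x\<close>, \<open>y\<close>, then \<^typ>\<open>'a\<close>, \<^typ>\<open>'b\<close> and the reals inject into \<^typ>\<open>'h\<close>), so a copy of it occurs
  among these \<open>G\<close>; and \<open>T\<close> is determined by \<open>\<Phi>\<close> because the tensors generate \<^typ>\<open>'h\<close>.\<close>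

definition fremlin_tensor_product ::
    "('a::archimedean_vector_lattice \<Rightarrow> 'b::archimedean_vector_lattice \<Rightarrow>
      'h::archimedean_vector_lattice) \<Rightarrow> bool" where
  "fremlin_tensor_product t \<longleftrightarrow>
     lattice_bimorphism t \<and>
     embeds_tensors t \<and>
     vector_sublattice hull (span {t x y | x y. True}) = UNIV \<and>
     (\<forall>G :: 'h vlat. archimedean_vlat G \<longrightarrow>
        (\<forall>\<Phi>. lattice_bimorphism_into G \<Phi> \<longrightarrow>
           (\<exists>!T. lattice_hom_into G T \<and> (\<forall>x y. T (t x y) = \<Phi> x y))))"


subsection \<open>The tensor product of two Riesz seminorms\<close>

definition tensor_unit_set ::
    "('a \<Rightarrow> 'b \<Rightarrow> 'h::vector_lattice) \<Rightarrow> ('a \<Rightarrow> real) \<Rightarrow> ('b \<Rightarrow> real) \<Rightarrow> 'h set" where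
  "tensor_unit_set t p q = Conv_b (Sol {t x y | x y. x \<in> {x. p x \<le> 1} \<and> y \<in> {y. q y \<le> 1}})"

definition tensor_seminorm ::
    "('a \<Rightarrow> 'b \<Rightarrow> 'h::vector_lattice) \<Rightarrow> ('a \<Rightarrow> real) \<Rightarrow> ('b \<Rightarrow> real) \<Rightarrow> 'h \<Rightarrow> real" where
  "tensor_seminorm t p q u = Inf {r. r > 0 \<and> u \<in> (\<lambda>w. r *\<^sub>R w) ` tensor_unit_set t p q}"

end

theory Submission
  imports Defs
begin

text \<open>Write \<open>x \<otimes> y\<close> for \<open>tensor x y\<close> and \<open>W\<close> for the unit set
  \<open>Conv_b (Sol (U \<otimes> V))\<close>. The theorem compares two infima over sets of real numbers: the radii
  \<open>r > 0\<close> with \<open>u \<in> r W\<close>, and the costs \<open>\<Sum> p x\<^sub>i q y\<^sub>i\<close> of the dominations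
  \<open>\<bar>u\<bar> \<le> \<Sum> x\<^sub>i \<otimes> y\<^sub>i\<close> by positive elementary tensors. Radii and costs convert into each other up
  to an arbitrarily small increase.

  A representation of \<open>u\<close> as \<open>r\<close> times an absolutely convex combination of elements \<open>w\<^sub>i\<close> with
  \<open>\<bar>w\<^sub>i\<bar> \<le> \<bar>x\<^sub>i \<otimes> y\<^sub>i\<bar> = \<bar>x\<^sub>i\<bar> \<otimes> \<bar>y\<^sub>i\<bar>\<close> gives, by the triangle inequality, a domination of cost at
  most \<open>r\<close> (\<open>scaled_unit_set_imp_dominated\<close>).

  Conversely, the Riesz decomposition property (\<open>riesz_decomposition_sum\<close>) splits a dominated \<open>u\<close>
  into pieces \<open>v\<^sub>i\<close> with \<open>\<bar>v\<^sub>i\<bar> \<le> x\<^sub>i \<otimes> y\<^sub>i\<close>, and normalising the two factors of each tensor turns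
  \<open>\<Sum> v\<^sub>i\<close> into a multiple of an absolutely convex combination
  (\<open>dominated_imp_scaled_unit_set\<close>). Since \<open>p x\<^sub>i\<close> or \<open>q y\<^sub>i\<close> may vanish, one divides by
  \<open>p x\<^sub>i + \<delta>\<close> and \<open>q y\<^sub>i + \<delta>\<close> instead. The argument therefore reaches the radii strictly above the cost,
  which have the same infimum.\<close>

lemma abs_scaleR_le:
  fixes x :: "'a::vector_lattice"
  shows "\<bar>c *\<^sub>R x\<bar> \<le> \<bar>c\<bar> *\<^sub>R \<bar>x\<bar>"
proof (cases "0 \<le> c")
  case True
  then show ?thesis
    by (intro abs_leI)
      (simp_all add: scaleR_left_mono abs_ge_self abs_ge_minus_self flip: scaleR_minus_right)
next
  case False
  then have "(- c) *\<^sub>R x \<le> (- c) *\<^sub>R \<bar>x\<bar>" "(- c) *\<^sub>R (- x) \<le> (- c) *\<^sub>R \<bar>x\<bar>"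
    by (intro scaleR_left_mono; simp add: abs_ge_self abs_ge_minus_self)+
  with False show ?thesis
    by (intro abs_leI) simp_all
qed

text \<open>The first piece is \<open>u\<close> truncated to the order interval from \<open>- a\<close> to \<open>a\<close>; what the
  truncation cuts off exceeds \<open>a\<close> in modulus by at most \<open>b\<close>.\<close>

lemma riesz_decomposition:
  fixes u :: "'a::vector_lattice"
  assumes "\<bar>u\<bar> \<le> a + b" "0 \<le> a" "0 \<le> b"
  obtains v w where "u = v + w" "\<bar>v\<bar> \<le> a" "\<bar>w\<bar> \<le> b"
proof -
  define v where "v = sup (- a) (inf u a)"
  have u: "u \<le> a + b" "- u \<le> a + b"
    using assms(1) abs_ge_self abs_ge_minus_self order_trans by blast+
  have "v \<le> a" "- a \<le> v"
    using assms(2) order_trans[of "- a" 0 a] by (simp_all add: v_def)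
  then have v: "\<bar>v\<bar> \<le> a"
    by (simp add: abs_leI minus_le_iff)
  have "- u - b \<le> a"
    using u(2) by (simp only: diff_le_eq)
  then have "- a \<le> u + b"
    using minus_le_iff[of "u + b" a] by simp
  moreover have "u - b \<le> a" "u - b \<le> u" "inf u a \<le> u + b"
    using u(1) assms(3) by (simp_all add: algebra_simps le_infI1 add_increasing)
  ultimately have "u - b \<le> v" "v \<le> u + b"
    unfolding v_def by (simp_all add: le_supI2)
  then have w: "\<bar>u - v\<bar> \<le> b"
    by (simp add: abs_leI algebra_simps)
  show thesis
    using that[of v "u - v"] v w by simp
qed

lemma riesz_decomposition_sum:
  fixes u :: "'a::vector_lattice" and z :: "nat \<Rightarrow> 'a"
  assumes "\<bar>u\<bar> \<le> (\<Sum>i<n. z i)" "\<And>i. i < n \<Longrightarrow> 0 \<le> z i"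
  shows "\<exists>v. u = (\<Sum>i<n. v i) \<and> (\<forall>i<n. \<bar>v i\<bar> \<le> z i)"
  using assms
proof (induction n arbitrary: u)
  case 0
  then show ?case by simp
next
  case (Suc n)
  have "\<bar>u\<bar> \<le> (\<Sum>i<n. z i) + z n" "0 \<le> (\<Sum>i<n. z i)" "0 \<le> z n"
    using Suc.prems by (auto intro: sum_nonneg)
  then obtain w w' where w: "u = w + w'" "\<bar>w\<bar> \<le> (\<Sum>i<n. z i)" "\<bar>w'\<bar> \<le> z n"
    by (rule riesz_decomposition)
  then obtain v where v: "w = (\<Sum>i<n. v i)" "\<forall>i<n. \<bar>v i\<bar> \<le> z i"
    using Suc.IH[of w] Suc.prems(2) by auto
  have "u = (\<Sum>i<Suc n. (v(n := w')) i)"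
    using w v by simp
  moreover have "\<forall>i<Suc n. \<bar>(v(n := w')) i\<bar> \<le> z i"
    using w v by (simp add: less_Suc_eq)
  ultimately show ?case by blast
qed

lemma lattice_bimorphism_nonneg:
  assumes "lattice_bimorphism t" "0 \<le> x" "0 \<le> y"
  shows "0 \<le> t x y"
  using assms unfolding lattice_bimorphism_def by (metis abs_ge_zero abs_of_nonneg)

lemma lattice_bimorphism_scaleR:
  assumes "lattice_bimorphism t"
  shows "t (a *\<^sub>R x) (b *\<^sub>R y) = (a * b) *\<^sub>R t x y"
  using assms by (simp add: lattice_bimorphism_def bilinear_lmul bilinear_rmul)

lemma riesz_seminorm_scaleR: "riesz_seminorm p \<Longrightarrow> p (c *\<^sub>R x) = \<bar>c\<bar> * p x"
  by (simp add: riesz_seminorm_def)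

lemma riesz_seminorm_abs: "riesz_seminorm p \<Longrightarrow> p \<bar>x\<bar> = p x"
  unfolding riesz_seminorm_def by (metis abs_idempotent order.refl order.antisym)

lemma riesz_seminorm_nonneg:
  assumes "riesz_seminorm p"
  shows "0 \<le> p x"
proof -
  have "p (0 *\<^sub>R x) = 0"
    using riesz_seminorm_scaleR[OF assms, of 0 x] by simp
  moreover have "p 0 \<le> p x"
    using assms abs_ge_zero[of x] unfolding riesz_seminorm_def by (metis abs_zero)
  ultimately show ?thesis by simp
qed

lemma scaled_unit_set_imp_dominated:
  fixes t :: "'a::vector_lattice \<Rightarrow> 'b::vector_lattice \<Rightarrow> 'h::vector_lattice"
  assumes t: "lattice_bimorphism t" and p: "riesz_seminorm p" and q: "riesz_seminorm q"
    and r: "0 < r" and u: "u \<in> (\<lambda>w. r *\<^sub>R w) ` tensor_unit_set t p q"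
  obtains n :: nat and x y where "\<forall>i<n. 0 \<le> x i \<and> 0 \<le> y i"
    and "\<bar>u\<bar> \<le> (\<Sum>i<n. t (x i) (y i))" and "(\<Sum>i<n. p (x i) * q (y i)) \<le> r"
proof -
  obtain n :: nat and l w where u_eq: "u = r *\<^sub>R (\<Sum>i<n. l i *\<^sub>R w i)"
    and w: "\<forall>i<n. w i \<in> Sol {t x y | x y. x \<in> {x. p x \<le> 1} \<and> y \<in> {y. q y \<le> 1}}"
    and l: "(\<Sum>i<n. \<bar>l i\<bar>) \<le> 1"
    using u unfolding tensor_unit_set_def Conv_b_def by auto
  have "\<forall>i. \<exists>x y. i < n \<longrightarrow> \<bar>w i\<bar> \<le> \<bar>t x y\<bar> \<and> p x \<le> 1 \<and> q y \<le> 1"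
    using w unfolding Sol_def by blast
  then obtain x y where xy: "\<And>i. i < n \<Longrightarrow> \<bar>w i\<bar> \<le> t \<bar>x i\<bar> \<bar>y i\<bar>"
      "\<And>i. i < n \<Longrightarrow> p (x i) \<le> 1" "\<And>i. i < n \<Longrightarrow> q (y i) \<le> 1"
    using t unfolding lattice_bimorphism_def by metis
  \<comment> \<open>The coefficients of the combination are absorbed into the left factors.\<close>
  define x' where "x' i = (r * \<bar>l i\<bar>) *\<^sub>R \<bar>x i\<bar>" for i
  show thesis
  proof (rule that[of n x' "\<lambda>i. \<bar>y i\<bar>"])
    show "\<forall>i<n. 0 \<le> x' i \<and> 0 \<le> \<bar>y i\<bar>"
      using r by (simp add: x'_def scaleR_nonneg_nonneg)
    have "u = (\<Sum>i<n. (r * l i) *\<^sub>R w i)"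
      by (simp add: u_eq scaleR_sum_right)
    also have "\<bar>\<dots>\<bar> \<le> (\<Sum>i<n. \<bar>(r * l i) *\<^sub>R w i\<bar>)"
      by (rule sum_abs)
    also have "\<dots> \<le> (\<Sum>i<n. t (x' i) \<bar>y i\<bar>)"
    proof (rule sum_mono)
      fix i assume "i \<in> {..<n}"
      have "\<bar>(r * l i) *\<^sub>R w i\<bar> \<le> \<bar>r * l i\<bar> *\<^sub>R \<bar>w i\<bar>"
        by (rule abs_scaleR_le)
      also have "\<dots> \<le> \<bar>r * l i\<bar> *\<^sub>R t \<bar>x i\<bar> \<bar>y i\<bar>"
        using xy(1) \<open>i \<in> {..<n}\<close> by (simp add: scaleR_left_mono)
      also have "\<dots> = t (x' i) \<bar>y i\<bar>"
        using lattice_bimorphism_scaleR[OF t, of "r * \<bar>l i\<bar>" "\<bar>x i\<bar>" 1 "\<bar>y i\<bar>"] r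
        by (simp add: x'_def abs_mult)
      finally show "\<bar>(r * l i) *\<^sub>R w i\<bar> \<le> t (x' i) \<bar>y i\<bar>" .
    qed
    finally show "\<bar>u\<bar> \<le> (\<Sum>i<n. t (x' i) \<bar>y i\<bar>)" .
    have "(\<Sum>i<n. p (x' i) * q \<bar>y i\<bar>) = (\<Sum>i<n. r * \<bar>l i\<bar> * (p (x i) * q (y i)))"
      using r by (simp add: x'_def riesz_seminorm_scaleR[OF p] riesz_seminorm_abs[OF p]
          riesz_seminorm_abs[OF q] abs_mult mult.assoc)
    also have "\<dots> \<le> (\<Sum>i<n. r * \<bar>l i\<bar> * 1)"
      using xy r by (intro sum_mono mult_left_mono mult_le_one)
        (simp_all add: riesz_seminorm_nonneg[OF q])
    also have "\<dots> \<le> r"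
      using l r by (simp flip: sum_distrib_left)
    finally show "(\<Sum>i<n. p (x' i) * q \<bar>y i\<bar>) \<le> r" .
  qed
qed

lemma dominated_imp_scaled_unit_set:
  fixes t :: "'a::vector_lattice \<Rightarrow> 'b::vector_lattice \<Rightarrow> 'h::vector_lattice"
    and x :: "nat \<Rightarrow> 'a" and y :: "nat \<Rightarrow> 'b"
  assumes t: "lattice_bimorphism t" and p: "riesz_seminorm p" and q: "riesz_seminorm q"
    and nonneg: "\<forall>i<n. 0 \<le> x i \<and> 0 \<le> y i" and u: "\<bar>u\<bar> \<le> (\<Sum>i<n. t (x i) (y i))"
    and r: "(\<Sum>i<n. p (x i) * q (y i)) < r"
  shows "u \<in> (\<lambda>w. r *\<^sub>R w) ` tensor_unit_set t p q"
proof -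
  have "((\<lambda>\<delta>. \<Sum>i<n. (p (x i) + \<delta>) * (q (y i) + \<delta>)) \<longlongrightarrow>
      (\<Sum>i<n. (p (x i) + 0) * (q (y i) + 0))) (at_right 0)"
    by (intro tendsto_intros)
  then have "\<forall>\<^sub>F \<delta> in at_right 0. (\<Sum>i<n. (p (x i) + \<delta>) * (q (y i) + \<delta>)) < r"
    using r by (intro order_tendstoD(2)) simp_all
  then have "\<forall>\<^sub>F \<delta> in at_right 0. (\<Sum>i<n. (p (x i) + \<delta>) * (q (y i) + \<delta>)) < r \<and> 0 < \<delta>"
    by (intro eventually_conj) (simp_all add: eventually_at_right_less)
  then obtain \<delta> :: real
    where \<delta>: "(\<Sum>i<n. (p (x i) + \<delta>) * (q (y i) + \<delta>)) < r" "0 < \<delta>"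
    using eventually_happens trivial_limit_at_right_real by blast
  define a b where "a i = p (x i) + \<delta>" and "b i = q (y i) + \<delta>" for i
  have ab: "0 < a i" "0 < b i" "p (x i) \<le> a i" "q (y i) \<le> b i" for i
    using \<delta> riesz_seminorm_nonneg[OF p] riesz_seminorm_nonneg[OF q]
    by (simp_all add: a_def b_def add_nonneg_pos)
  have "0 \<le> (\<Sum>i<n. p (x i) * q (y i))"
    by (intro sum_nonneg mult_nonneg_nonneg riesz_seminorm_nonneg[OF p] riesz_seminorm_nonneg[OF q])
  then have r_pos: "0 < r"
    using r by linarith
  obtain v where v: "u = (\<Sum>i<n. v i)" "\<And>i. i < n \<Longrightarrow> \<bar>v i\<bar> \<le> t (x i) (y i)"
    using riesz_decomposition_sum[OF u] nonneg lattice_bimorphism_nonneg[OF t] by blast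
  define w where "w i = inverse (a i * b i) *\<^sub>R v i" for i
  define l where "l i = a i * b i / r" for i
  have "w i \<in> Sol {t x y | x y. x \<in> {x. p x \<le> 1} \<and> y \<in> {y. q y \<le> 1}}" if "i < n" for i
  proof -
    have "\<bar>w i\<bar> \<le> inverse (a i * b i) *\<^sub>R \<bar>v i\<bar>"
      using abs_scaleR_le[of "inverse (a i * b i)" "v i"] ab(1,2)[of i] by (simp add: w_def)
    also have "\<dots> \<le> inverse (a i * b i) *\<^sub>R t (x i) (y i)"
      using v(2) that ab(1,2)[of i] by (intro scaleR_left_mono) simp_all
    also have "\<dots> = t (inverse (a i) *\<^sub>R x i) (inverse (b i) *\<^sub>R y i)"
      by (simp add: lattice_bimorphism_scaleR[OF t])
    also have "\<dots> \<le> \<bar>t (inverse (a i) *\<^sub>R x i) (inverse (b i) *\<^sub>R y i)\<bar>"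
      by (rule abs_ge_self)
    finally have "\<bar>w i\<bar> \<le> \<bar>t (inverse (a i) *\<^sub>R x i) (inverse (b i) *\<^sub>R y i)\<bar>" .
    moreover have "p (inverse (a i) *\<^sub>R x i) \<le> 1" "q (inverse (b i) *\<^sub>R y i) \<le> 1"
      using ab[of i] by (simp_all add: riesz_seminorm_scaleR[OF p] riesz_seminorm_scaleR[OF q]
          divide_le_eq flip: divide_inverse_commute)
    ultimately show ?thesis
      unfolding Sol_def by blast
  qed
  moreover have "(\<Sum>i<n. \<bar>l i\<bar>) \<le> 1"
  proof -
    have "(\<Sum>i<n. \<bar>l i\<bar>) = (\<Sum>i<n. a i * b i) / r"
      using ab r_pos by (simp add: l_def abs_mult abs_of_pos sum_divide_distrib)
    then show ?thesis
      using \<delta>(1) r_pos by (simp add: a_def b_def)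
  qed
  ultimately have "(\<Sum>i<n. l i *\<^sub>R w i) \<in> tensor_unit_set t p q"
    unfolding tensor_unit_set_def Conv_b_def by blast
  moreover have "u = r *\<^sub>R (\<Sum>i<n. l i *\<^sub>R w i)"
  proof -
    have "r *\<^sub>R l i *\<^sub>R w i = v i" for i
      using ab(1,2)[of i] r_pos by (simp add: l_def w_def field_simps)
    then show ?thesis
      by (simp add: v(1) scaleR_sum_right)
  qed
  ultimately show ?thesis by blast
qed

text \<open>The statement includes the case that both sets are empty, where the two infima are the same
  unspecified value.\<close>

lemma Inf_eq_up_to_increase:
  fixes A B :: "real set"
  assumes "bdd_below A" "bdd_below B"
    and "\<And>r. r \<in> A \<Longrightarrow> \<exists>s\<in>B. s \<le> r" and "\<And>s r. s \<in> B \<Longrightarrow> s < r \<Longrightarrow> r \<in> A"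
  shows "Inf A = Inf B"
proof (cases "B = {}")
  case True
  then show ?thesis using assms(3) by (metis empty_iff equals0I)
next
  case False
  then have "A \<noteq> {}"
    using assms(4) gt_ex by (metis empty_iff equals0I)
  show ?thesis
  proof (rule antisym)
    show "Inf A \<le> Inf B"
    proof (rule cInf_greatest[OF False])
      fix s assume "s \<in> B"
      then have "Inf A \<le> r" if "s < r" for r
        using assms(1,4) that by (intro cInf_lower) auto
      then show "Inf A \<le> s"
        by (rule dense_ge)
    qed
    show "Inf B \<le> Inf A"
      using \<open>A \<noteq> {}\<close> assms(2,3) by (intro cInf_mono) auto
  qed
qed

theorem theorem5:
  fixes \<tau>E :: "'a::archimedean_vector_lattice topology"
    and \<tau>F :: "'b::archimedean_vector_lattice topology"
    and I :: "'i set" and p :: "'i \<Rightarrow> 'a \<Rightarrow> real"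
    and J :: "'j set" and q :: "'j \<Rightarrow> 'b \<Rightarrow> real"
    and tensor :: "'a \<Rightarrow> 'b \<Rightarrow> 'h::archimedean_vector_lattice"
    and \<alpha> :: 'i and \<beta> :: 'j and u :: 'h
  assumes "locally_convex_solid \<tau>E" and "locally_convex_solid \<tau>F"
    and "\<And>i. i \<in> I \<Longrightarrow> riesz_seminorm (p i)" and "\<And>j. j \<in> J \<Longrightarrow> riesz_seminorm (q j)"
    and "\<tau>E = seminorm_topology I p" and "\<tau>F = seminorm_topology J q"
    and "fremlin_tensor_product tensor"
    and "\<alpha> \<in> I" and "\<beta> \<in> J"
  shows "tensor_seminorm tensor (p \<alpha>) (q \<beta>) u =
    Inf {\<Sum>i<n. p \<alpha> (x i) * q \<beta> (y i) | (n::nat) x y.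
           (\<forall>i<n. 0 \<le> x i \<and> 0 \<le> y i) \<and> \<bar>u\<bar> \<le> (\<Sum>i<n. tensor (x i) (y i))}"
proof -
  have t: "lattice_bimorphism tensor"
    using assms(7) by (simp add: fremlin_tensor_product_def)
  have p: "riesz_seminorm (p \<alpha>)" and q: "riesz_seminorm (q \<beta>)"
    using assms by auto
  have cost_nonneg: "0 \<le> (\<Sum>i<n. p \<alpha> (x i) * q \<beta> (y i))" for n :: nat and x y
    by (intro sum_nonneg mult_nonneg_nonneg riesz_seminorm_nonneg[OF p] riesz_seminorm_nonneg[OF q])
  show ?thesis
    unfolding tensor_seminorm_def
  proof (rule Inf_eq_up_to_increase, goal_cases)
    case 1
    show ?case by (rule bdd_belowI[of _ 0]) auto
  next
    case 2
    show ?case using cost_nonneg by (intro bdd_belowI[of _ 0]) auto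
  next
    case (3 r)
    then have "0 < r" "u \<in> (\<lambda>w. r *\<^sub>R w) ` tensor_unit_set tensor (p \<alpha>) (q \<beta>)"
      by auto
    with t p q obtain n :: nat and x y where "\<forall>i<n. 0 \<le> x i \<and> 0 \<le> y i"
      and "\<bar>u\<bar> \<le> (\<Sum>i<n. tensor (x i) (y i))"
      and "(\<Sum>i<n. p \<alpha> (x i) * q \<beta> (y i)) \<le> r"
      by (rule scaled_unit_set_imp_dominated)
    then show ?case
      by (intro bexI[of _ "\<Sum>i<n. p \<alpha> (x i) * q \<beta> (y i)"] CollectI exI[of _ n] exI[of _ x]
          exI[of _ y] conjI refl)
  next
    case (4 s r)
    then obtain n :: nat and x y where s: "s = (\<Sum>i<n. p \<alpha> (x i) * q \<beta> (y i))"
      and xy: "\<forall>i<n. 0 \<le> x i \<and> 0 \<le> y i" "\<bar>u\<bar> \<le> (\<Sum>i<n. tensor (x i) (y i))"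
      by (elim CollectE exE conjE)
    have "u \<in> (\<lambda>w. r *\<^sub>R w) ` tensor_unit_set tensor (p \<alpha>) (q \<beta>)"
      using t p q xy \<open>s < r\<close>[unfolded s] by (rule dominated_imp_scaled_unit_set)
    moreover have "0 < r"
      using cost_nonneg \<open>s < r\<close>[unfolded s] by (rule le_less_trans)
    ultimately show ?case by (intro CollectI conjI)
  qed
qed

end
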